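(* Let $G=(V,E)$ be a tree with $n\ge2$ nodes and fixed delays $m_{i,j}$, and let $(\mathcal{N}^e,\mathcal{N}^m)$ be an identification pattern with $N^{m,e}=|\mathcal{N}^e|+|\mathcal{N}^m|=n$. Then $G$ is identifiable in the class $\mathcal{F}_{Z,NL}$ with $(\mathcal{N}^e,\mathcal{N}^m)$ if and only if all the sources are excited, all the sinks are measured, and every other node is either excited or measured.
   Context: Graph. $G=(V,E)$ is a directed graph, $V=\{1,\dots,n\}$, $E\subseteq V\times V$. An element $(i,j)\in E$ denotes an edge from $j$ to $i$; $\mathcal{N}_i=\{j:(i,j)\in E\}$ is the set of in-neighbors of $i$. A tree is a directed graph whose underlying undirected graph is a tree (connected, without cycles; each undirected edge carries exactly one orientation); it may have several sources and several sinks, and it is in particular a weakly connected directed acyclic graph. A source is a node with no in-neighbors; a sink is a node with no out-neighbors. Identification pattern. A pair $(\mathcal{N}^e,\mathcal{N}^m)$ with $\mathcal{N}^e\subseteq V$ (excited nodes) and $\mathcal{N}^m\subseteq V$ (measured nodes). The number of identification actions is $N^{m,e}=|\mathcal{N}^e|+|\mathcal{N}^m|$. Model. Each edge $(i,j)\in E$ carries a fixed known finite delay $m_{i,j}\in\{1,2,\dots\}$ and a function $f_{i,j}:\mathbb{R}\to\mathbb{R}$. The node outputs satisfy, at each time $k$, $$y_i^k=\sum_{j\in\mathcal{N}_i} f_{i,j}\big(y_j^{k-m_{i,j}}\big)+u_i^{k-1},\qquad i\in V,$$ where superscripts denote time instants, $u_i$ is an arbitrary real excitation signal if $i\in\mathcal{N}^e$,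 and $u_i\equiv 0$ if $i\notin\mathcal{N}^e$. The functions $F_i$. Since $G$ is acyclic, unrolling the model gives $y_i^k=u_i^{k-1}+F_i$, where $F_i$ is a function of finitely many delayed values $u_j^{k-s}$ of the excitation signals of excited nodes $j$ having a path to $i$. Explicitly, $F_i=\sum_{j\in\mathcal{N}_i} f_{i,j}\big(u_j^{k-m_{i,j}-1}+F_j^{(m_{i,j})}\big)$, where $F_j^{(s)}$ is $F_j$ with all its inputs delayed by $s$, and $u_j=0$ for non-excited $j$. The set of measured functions is $F(\mathcal{N}^m)=\{F_i: i\in\mathcal{N}^m\}$. For another family $\{\tilde f\}=\{\tilde f_{i,j}\}$ on the same graph with the same delays and pattern, $\tilde F_i$ denotes the corresponding functions; $F(\mathcal{N}^m)=\tilde F(\mathcal{N}^m)$ means $F_i=\tilde F_i$ as functions (for all real values of the inputs) for each $i\in\mathcal{N}^m$. Class $\mathcal{F}_{Z,NL}$. The set of $f:\mathbb{R}\to\mathbb{R}$ such that: (1) $f$ is real analytic on $\mathbb{R}$; (2) $f(0)=0$; (3) the Taylor series $f(x)=\sum_{n\ge1}a_nx^n$ at $0$ has some $a_n\ne0$ with $n>1$; (4) the range of $f$ is $\mathbb{R}$. Identifiability. $G$ is identifiable in $\mathcal{F}_{Z,NL}$ with $(\mathcal{N}^e,\mathcal{N}^m)$ if, for all families $\{f_{i,j}\}_{(i,j)\in E}$ and $\{\tilde f_{i,j}\}_{(i,j)\in E}$ of functions in $\mathcal{F}_{Z,NL}$, $F(\mathcal{N}^m)=\tilde F(\mathcal{N}^m)$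 implies $f_{i,j}=\tilde f_{i,j}$ for all $(i,j)\in E$. *)

theory Defs
  imports "HOL-Analysis.Analysis"
begin

text \<open>
  A digraph is a vertex set together with an edge relation; a pair \<open>(i, j)\<close> in the relation is an
  edge \<^emph>\<open>from \<open>j\<close> to \<open>i\<close>\<close>.
\<close>

type_synonym edges = "(nat \<times> nat) set"

definition in_neighbors :: "edges \<Rightarrow> nat \<Rightarrow> nat set" where
  "in_neighbors E i = {j. (i, j) \<in> E}"

definition out_neighbors :: "edges \<Rightarrow> nat \<Rightarrow> nat set" where
  "out_neighbors E i = {l. (l, i) \<in> E}"

definition sources :: "nat set \<Rightarrow> edges \<Rightarrow> nat set" where
  "sources V E = {i \<in> V. in_neighbors E i = {}}"

definition sinks :: "nat set \<Rightarrow> edges \<Rightarrow> nat set" where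
  "sinks V E = {i \<in> V. out_neighbors E i = {}}"

text \<open>A cycle of an undirected graph (a symmetric relation), as the list of its vertices.\<close>

definition ucycle :: "(nat \<times> nat) set \<Rightarrow> nat list \<Rightarrow> bool" where
  "ucycle R p \<longleftrightarrow> 3 \<le> length p \<and> distinct p \<and>
     (\<forall>k. Suc k < length p \<longrightarrow> (p ! k, p ! Suc k) \<in> R) \<and> (last p, hd p) \<in> R"

text \<open>
  The underlying undirected graph is \<open>E \<union> E\<inverse>\<close>. Asymmetry says that there are no loops and that each
  undirected edge carries exactly one orientation.
\<close>

definition directed_tree :: "nat set \<Rightarrow> edges \<Rightarrow> bool" where
  "directed_tree V E \<longleftrightarrow> V \<noteq> {} \<and> E \<subseteq> V \<times> V \<and> asym E \<and>
     (\<forall>i\<in>V. \<forall>j\<in>V. (i, j) \<in> (E \<union> E\<inverse>)\<^sup>*) \<and> (\<nexists>p. ucycle (E \<union> E\<inverse>) p)"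

lemma directed_tree_acyclic:
  assumes "directed_tree V E"
  shows "acyclic E"
proof (rule ccontr)
  assume "\<not> acyclic E"
  then obtain x0 where "(x0, x0) \<in> E\<^sup>+"
    by (auto simp: acyclic_def)
  then obtain n0 where "n0 > 0" "(x0, x0) \<in> E ^^ n0"
    using trancl_power by blast
  then have ex: "\<exists>n>0. \<exists>x. (x, x) \<in> E ^^ n" by blast
  define n where "n = (LEAST n. n > 0 \<and> (\<exists>x. (x, x) \<in> E ^^ n))"
  have n: "n > 0" "\<exists>x. (x, x) \<in> E ^^ n"
    using LeastI_ex[OF ex] unfolding n_def by auto
  have minimal: "n \<le> d" if "d > 0" "(x, x) \<in> E ^^ d" for d x
    unfolding n_def by (rule Least_le) (use that in blast)
  obtain g where g: "g 0 = g n" "\<And>k. k < n \<Longrightarrow> (g k, g (Suc k)) \<in> E"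
    using n(2) unfolding relpow_fun_conv by metis
  have "inj_on g {..<n}"
  proof (rule linorder_inj_onI)
    fix a b assume ab: "a < b" "a \<in> {..<n}" "b \<in> {..<n}"
    show "g a \<noteq> g b"
    proof
      assume eq: "g a = g b"
      have "(g a, g b) \<in> E ^^ (b - a)"
        unfolding relpow_fun_conv
        by (rule exI[of _ "\<lambda>k. g (a + k)"]) (use ab g(2) in auto)
      then have "n \<le> b - a" using minimal[of "b - a" "g b"] ab eq by simp
      then show False using ab by auto
    qed
  qed auto
  then have dist: "distinct (map g [0..<n])"
    by (simp add: distinct_map atLeast0LessThan)
  have lst: "(last (map g [0..<n]), hd (map g [0..<n])) \<in> E"
    using g(1) g(2)[of "n - 1"] n(1) by (simp add: last_map hd_map)
  have asy: "(a, b) \<notin> E" if "(b, a) \<in> E" for a b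
    using assms that by (auto simp: directed_tree_def dest: asymD)
  have "n \<noteq> 1" using g asy by force
  moreover have "n \<noteq> 2"
    using g(1) g(2)[of 0] g(2)[of 1] asy by (auto simp: numeral_2_eq_2)
  ultimately have "3 \<le> n" using n(1) by simp
  then have "ucycle (E \<union> E\<inverse>) (map g [0..<n])"
    using dist lst g(2) by (auto simp: ucycle_def)
  then show False using assms by (auto simp: directed_tree_def)
qed

text \<open>
  An argument \<open>w\<close> of the unrolled function assigns to \<open>j\<close> and \<open>s\<close> the value of \<open>u\<^sub>j\<close> at time \<open>k - s\<close>,
  so that delaying all the inputs by \<open>d\<close> amounts to passing \<open>\<lambda>l s. w l (s + d)\<close>. The recursion is
  over \<open>E\<inverse>\<close>, which is well-founded for a finite acyclic \<open>E\<close>. The function does not depend on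
  the entries of \<open>w\<close> at nodes that are not excited, nor on all but finitely many of the other entries.
\<close>

definition unrolled ::
  "edges \<Rightarrow> (nat \<Rightarrow> nat \<Rightarrow> nat) \<Rightarrow> nat set \<Rightarrow> (nat \<Rightarrow> nat \<Rightarrow> real \<Rightarrow> real) \<Rightarrow>
     nat \<Rightarrow> (nat \<Rightarrow> nat \<Rightarrow> real) \<Rightarrow> real" where
  "unrolled E m Ne f = wfrec (E\<inverse>) (\<lambda>F i w. \<Sum>j\<in>in_neighbors E i.
     f i j ((if j \<in> Ne then w j (m i j + 1) else 0) + F j (\<lambda>l s. w l (s + m i j))))"

lemma unrolled_rec:
  assumes "finite E" "acyclic E"
  shows "unrolled E m Ne f i w = (\<Sum>j\<in>in_neighbors E i.
     f i j ((if j \<in> Ne then w j (m i j + 1) else 0)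
            + unrolled E m Ne f j (\<lambda>l s. w l (s + m i j))))"
  unfolding unrolled_def
  by (subst wfrec[OF finite_acyclic_wf_converse[OF assms]])
     (auto intro!: sum.cong simp: cut_apply in_neighbors_def)

text \<open>
  The network equations on a bi-infinite time axis. Every trajectory satisfies
  \<open>y\<^sub>i\<^sup>k = u\<^sub>i\<^sup>k\<^sup>-\<^sup>1 + F\<^sub>i\<close>, where \<open>F\<^sub>i\<close> is the unrolled function above.
\<close>

definition trajectory ::
  "nat set \<Rightarrow> edges \<Rightarrow> (nat \<Rightarrow> nat \<Rightarrow> nat) \<Rightarrow> nat set \<Rightarrow> (nat \<Rightarrow> nat \<Rightarrow> real \<Rightarrow> real) \<Rightarrow>
     (nat \<Rightarrow> int \<Rightarrow> real) \<Rightarrow> (nat \<Rightarrow> int \<Rightarrow> real) \<Rightarrow> bool" where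
  "trajectory V E m Ne f u y \<longleftrightarrow>
     (\<forall>i\<in>V. \<forall>k. y i k = (\<Sum>j\<in>in_neighbors E i. f i j (y j (k - int (m i j)))) + u i (k - 1)) \<and>
     (\<forall>i\<in>V - Ne. \<forall>k. u i k = 0)"

lemma trajectory_unrolled:
  assumes "finite E" "acyclic E" "E \<subseteq> V \<times> V" and traj: "trajectory V E m Ne f u y" and "i \<in> V"
  shows "y i k = u i (k - 1) + unrolled E m Ne f i (\<lambda>j s. u j (k - int s))"
  using \<open>i \<in> V\<close>
proof (induction i arbitrary: k rule: wf_induct_rule[OF finite_acyclic_wf_converse[OF assms(1,2)]])
  case (1 i)
  have "f i j (y j (k - int (m i j))) =
      f i j ((if j \<in> Ne then u j (k - int (m i j + 1)) else 0)
             + unrolled E m Ne f j (\<lambda>l s. u l (k - int (s + m i j))))"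
    if "j \<in> in_neighbors E i" for j
  proof -
    have j: "(j, i) \<in> E\<inverse>" "j \<in> V" using that assms(3) by (auto simp: in_neighbors_def)
    have "u j t = (if j \<in> Ne then u j t else 0)" for t
      using traj j(2) by (auto simp: trajectory_def)
    then show ?thesis
      using 1(1)[OF j, of "k - int (m i j)"] by (simp add: algebra_simps)
  qed
  then have "(\<Sum>j\<in>in_neighbors E i. f i j (y j (k - int (m i j)))) =
      unrolled E m Ne f i (\<lambda>j s. u j (k - int s))"
    by (subst unrolled_rec[OF assms(1,2)]) (auto intro: sum.cong)
  then show ?case using traj 1(2) by (auto simp: trajectory_def)
qed

definition real_analytic :: "(real \<Rightarrow> real) \<Rightarrow> bool" where
  "real_analytic f \<longleftrightarrow> (\<forall>x. \<exists>A. (\<lambda>h. f (x + h)) has_fps_expansion A)"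

definition class_Z_NL :: "(real \<Rightarrow> real) set" where
  "class_Z_NL = {f. real_analytic f \<and> f 0 = 0 \<and>
     (\<exists>A. f has_fps_expansion A \<and> (\<exists>n>1. fps_nth A n \<noteq> 0)) \<and> range f = UNIV}"

text \<open>
  The values of a family \<open>f\<close> at pairs that are not edges play no role.
\<close>

definition identifiable ::
  "(real \<Rightarrow> real) set \<Rightarrow> edges \<Rightarrow> (nat \<Rightarrow> nat \<Rightarrow> nat) \<Rightarrow> nat set \<Rightarrow> nat set \<Rightarrow> bool" where
  "identifiable C E m Ne Nm \<longleftrightarrow>
     (\<forall>f f'. (\<forall>(i, j)\<in>E. f i j \<in> C \<and> f' i j \<in> C) \<longrightarrow>
        (\<forall>i\<in>Nm. unrolled E m Ne f i = unrolled E m Ne f' i) \<longrightarrow>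
        (\<forall>(i, j)\<in>E. f i j = f' i j))"

end

theory Submission
  imports Defs "HOL-Library.Transitive_Closure_Table"
begin

text \<open>
  Sufficiency: in a tree the ancestor sets of distinct in-neighbours of \<open>i\<close> are disjoint, so zeroing
  all other inputs extracts each single term \<open>f\<^sub>i\<^sub>j (u\<^sub>j + F\<^sub>j)\<close> from \<open>F\<^sub>i\<close>. If \<open>j\<close> is excited, taking
  \<open>F\<^sub>j = 0\<close> gives \<open>f\<^sub>i\<^sub>j\<close>, and then \<open>F\<^sub>j\<close> is determined because a continuous surjection of the reals is
  not periodic. If \<open>j\<close> is measured, \<open>F\<^sub>j\<close> is given and surjective, which gives \<open>f\<^sub>i\<^sub>j\<close>. So knowledge of
  \<open>F\<close> propagates from the sinks against the edges to the whole tree.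

  Necessity: at a node that is not excited (or is a sink), doubling the incoming functions and
  undoing this in the outgoing ones affects no other node, and the change of \<open>F\<^sub>i\<close> itself is not
  observed if \<open>i\<close> is unmeasured (or a source, where \<open>F\<^sub>i = 0\<close>).
\<close>

section \<open>Branches of a tree\<close>

text \<open>If \<open>j\<close> and \<open>l\<close> differed, a simple path between them off
  \<open>i\<close> would have at least one edge and close up through \<open>i\<close> to a cycle of
  length at least 3.\<close>

lemma no_ucycle_avoiding_unique:
  assumes nocyc: "\<nexists>p. ucycle R p"
    and ij: "(i, j) \<in> R" and li: "(l, i) \<in> R"
    and conn: "(j, l) \<in> {(x, y) \<in> R. x \<noteq> i \<and> y \<noteq> i}\<^sup>*" and "j \<noteq> i"
  shows "j = l"
proof (rule ccontr)
  assume "j \<noteq> l"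
  define r where "r = (\<lambda>x y. (x, y) \<in> R \<and> x \<noteq> i \<and> y \<noteq> i)"
  have "r\<^sup>*\<^sup>* j l"
    using conn by (simp add: r_def rtranclp_rtrancl_eq)
  then obtain xs where "rtrancl_path r j xs l" "distinct (j # xs)"
    by (metis rtranclp_eq_rtrancl_path rtrancl_path_distinct)
  note path = this
  have "xs \<noteq> []"
    using path(1) \<open>j \<noteq> l\<close> by (auto elim: rtrancl_path.cases)
  have nth: "r ((j # xs) ! k) (xs ! k)" if "k < length xs" for k
    using rtrancl_path_nth[OF path(1) that] .
  have "i \<notin> set xs"
    using nth by (auto simp: in_set_conv_nth r_def)
  have "last xs = l"
    using rtrancl_path_last[OF path(1) \<open>xs \<noteq> []\<close>] .
  have "ucycle R (i # j # xs)"
    unfolding ucycle_def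
  proof (intro conjI allI impI)
    show "3 \<le> length (i # j # xs)"
      using \<open>xs \<noteq> []\<close> by (cases xs) auto
    show "distinct (i # j # xs)"
      using path(2) \<open>i \<notin> set xs\<close> \<open>j \<noteq> i\<close> by auto
    show "((i # j # xs) ! k, (i # j # xs) ! Suc k) \<in> R" if "Suc k < length (i # j # xs)" for k
    proof (cases k)
      case 0
      then show ?thesis using ij by simp
    next
      case (Suc k')
      then show ?thesis using nth[of k'] that by (simp add: r_def)
    qed
    show "(last (i # j # xs), hd (i # j # xs)) \<in> R"
      using \<open>xs \<noteq> []\<close> \<open>last xs = l\<close> li by simp
  qed
  then show False using nocyc by blast
qed

text \<open>A walk along pairs of \<open>E\<close> from \<open>j\<close> that met \<open>i\<close>
  would close a directed cycle with the pair \<open>(i, j)\<close>.\<close>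

lemma acyclic_rtrancl_avoiding:
  assumes "acyclic E" "(i, j) \<in> E" "(j, a) \<in> E\<^sup>*"
  shows "(j, a) \<in> {(x, y) \<in> E. x \<noteq> i \<and> y \<noteq> i}\<^sup>*"
  using assms(3)
proof (induction rule: rtrancl_induct)
  case (step y z)
  have "y \<noteq> i"
    using assms(1,2) step.hyps(1) by (metis acyclic_def rtrancl_into_trancl2)
  moreover have "z \<noteq> i"
    using assms(1,2) step.hyps
    by (metis acyclic_def rtrancl.rtrancl_into_rtrancl rtrancl_into_trancl2)
  ultimately have "(y, z) \<in> {(x, y) \<in> E. x \<noteq> i \<and> y \<noteq> i}"
    using step.hyps(2) by simp
  then show ?case using step.IH by (rule rtrancl_into_rtrancl[rotated])
qed simp

text \<open>Pairs of \<open>E\<close> lead from a node to its in-neighbours, so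
  \<open>E\<^sup>*\<close> leads to ancestors. Going from \<open>j\<close> up to the common ancestor
  \<open>a\<close> and back down to \<open>l\<close> is an undirected walk that avoids
  \<open>i\<close>.\<close>

lemma directed_tree_ancestors_disjoint:
  assumes tree: "directed_tree V E"
    and j: "(i, j) \<in> E" "(j, a) \<in> E\<^sup>*" and l: "(i, l) \<in> E" "(l, a) \<in> E\<^sup>*"
  shows "j = l"
proof -
  let ?R = "E \<union> E\<inverse>" and ?A = "{(x, y) \<in> E. x \<noteq> i \<and> y \<noteq> i}"
  let ?S = "{(x, y) \<in> ?R. x \<noteq> i \<and> y \<noteq> i}"
  have acyc: "acyclic E" by (rule directed_tree_acyclic[OF tree])
  have "(j, a) \<in> ?S\<^sup>*"
    by (rule subsetD[OF rtrancl_mono acyclic_rtrancl_avoiding[OF acyc j]]) auto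
  moreover have "(a, l) \<in> (?A\<inverse>)\<^sup>*"
    using acyclic_rtrancl_avoiding[OF acyc l] by (simp add: rtrancl_converse)
  then have "(a, l) \<in> ?S\<^sup>*"
    by (rule subsetD[OF rtrancl_mono, rotated]) auto
  ultimately have "(j, l) \<in> ?S\<^sup>*" by (rule rtrancl_trans)
  moreover have "j \<noteq> i" using acyc j(1) by (auto simp: acyclic_def)
  ultimately show ?thesis
    using tree j(1) l(1) by (intro no_ucycle_avoiding_unique[of ?R i j l]) (auto simp: directed_tree_def)
qed

lemma directed_tree_finite:
  "directed_tree V E \<Longrightarrow> finite V \<Longrightarrow> finite E"
  by (rule finite_subset[of E "V \<times> V"]) (simp_all add: directed_tree_def)

section \<open>Unrolled functions\<close>

lemma unrolled_cong:
  assumes "finite E" "acyclic E"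
    and "\<And>l s. (i, l) \<in> E\<^sup>+ \<Longrightarrow> w l s = w' l s"
  shows "unrolled E m Ne f i w = unrolled E m Ne f i w'"
  using assms(3)
proof (induction i arbitrary: w w' rule: wf_induct_rule[OF finite_acyclic_wf_converse[OF assms(1,2)]])
  case (1 i)
  have IH: "unrolled E m Ne f j (\<lambda>l s. w l (s + m i j)) = unrolled E m Ne f j (\<lambda>l s. w' l (s + m i j))"
    if "(i, j) \<in> E" for j
  proof (rule 1(1))
    show "(j, i) \<in> E\<inverse>" using that by simp
    show "w l (s + m i j) = w' l (s + m i j)" if "(j, l) \<in> E\<^sup>+" for l s
      by (rule 1(2)[OF trancl_into_trancl2[OF \<open>(i, j) \<in> E\<close> that]])
  qed
  show ?case
    unfolding unrolled_rec[OF assms(1,2), of m Ne f i]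
  proof (rule sum.cong[OF refl])
    fix j assume "j \<in> in_neighbors E i"
    then have j: "(i, j) \<in> E" by (simp add: in_neighbors_def)
    show "f i j ((if j \<in> Ne then w j (m i j + 1) else 0) + unrolled E m Ne f j (\<lambda>l s. w l (s + m i j))) =
      f i j ((if j \<in> Ne then w' j (m i j + 1) else 0) + unrolled E m Ne f j (\<lambda>l s. w' l (s + m i j)))"
      by (simp only: IH[OF j] 1(2)[OF r_into_trancl, OF j])
  qed
qed

lemma unrolled_zero:
  assumes "finite E" "acyclic E" and f0: "\<forall>(a, b)\<in>E. f a b 0 = 0"
    and "\<And>l s. (i, l) \<in> E\<^sup>+ \<Longrightarrow> w l s = 0"
  shows "unrolled E m Ne f i w = 0"
  using assms(4)
proof (induction i arbitrary: w rule: wf_induct_rule[OF finite_acyclic_wf_converse[OF assms(1,2)]])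
  case (1 i)
  have IH: "unrolled E m Ne f j (\<lambda>l s. w l (s + m i j)) = 0" if "(i, j) \<in> E" for j
  proof (rule 1(1))
    show "(j, i) \<in> E\<inverse>" using that by simp
    show "w l (s + m i j) = 0" if "(j, l) \<in> E\<^sup>+" for l s
      by (rule 1(2)[OF trancl_into_trancl2[OF \<open>(i, j) \<in> E\<close> that]])
  qed
  show ?case
    unfolding unrolled_rec[OF assms(1,2), of m Ne f i]
  proof (intro sum.neutral ballI)
    fix j assume "j \<in> in_neighbors E i"
    then have j: "(i, j) \<in> E" by (simp add: in_neighbors_def)
    then show "f i j ((if j \<in> Ne then w j (m i j + 1) else 0) + unrolled E m Ne f j (\<lambda>l s. w l (s + m i j))) = 0"
      using f0 by (auto simp: IH[OF j] 1(2)[OF r_into_trancl, OF j])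
  qed
qed

text \<open>The shift of \<open>w\<close> by \<open>m i j\<close> cancels the delay that the
  recursion adds on the edge from \<open>j\<close> to \<open>i\<close>. Truncated subtraction is
  harmless, since \<open>w\<close> is then only read at times \<open>s + m i j\<close>.\<close>

definition branch_input ::
  "edges \<Rightarrow> (nat \<Rightarrow> nat \<Rightarrow> nat) \<Rightarrow> nat \<Rightarrow> nat \<Rightarrow> real \<Rightarrow> (nat \<Rightarrow> nat \<Rightarrow> real) \<Rightarrow> nat \<Rightarrow> nat \<Rightarrow> real" where
  "branch_input E m i j x w =
     (\<lambda>l s. if l = j then x else if (j, l) \<in> E\<^sup>+ then w l (s - m i j) else 0)"

text \<open>The value \<open>x\<close> and the input \<open>w\<close> can be prescribed
  independently, because by acyclicity the unrolled function at \<open>j\<close> does not read the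
  input at \<open>j\<close>. Every other in-neighbour has no ancestor in common with
  \<open>j\<close>, so its term is a value at 0.\<close>

lemma unrolled_branch_input:
  assumes tree: "directed_tree V E" and fin: "finite E"
    and f0: "\<forall>(a, b)\<in>E. f a b 0 = 0" and ij: "(i, j) \<in> E"
  shows "unrolled E m Ne f i (branch_input E m i j x w) =
    f i j ((if j \<in> Ne then x else 0) + unrolled E m Ne f j w)"
proof -
  let ?w = "branch_input E m i j x w"
  have acyc: "acyclic E" by (rule directed_tree_acyclic[OF tree])
  have irr: "(a, a) \<notin> E\<^sup>+" for a using acyc by (auto simp: acyclic_def)
  \<comment> \<open>The case \<open>a = l\<close> is included, so this covers both the direct input
    at another in-neighbour and the inputs at its ancestors.\<close>
  have zero: "?w a s = 0" if "(i, l) \<in> E" "(l, a) \<in> E\<^sup>*" "l \<noteq> j" for a l s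
    using directed_tree_ancestors_disjoint[OF tree ij _ that(1,2)] that(3)
    by (auto simp: branch_input_def dest: trancl_into_rtrancl)
  have other: "f i l ((if l \<in> Ne then ?w l (m i l + 1) else 0)
      + unrolled E m Ne f l (\<lambda>a s. ?w a (s + m i l))) = 0" if "(i, l) \<in> E" "l \<noteq> j" for l
  proof -
    have "unrolled E m Ne f l (\<lambda>a s. ?w a (s + m i l)) = 0"
      by (rule unrolled_zero[where f = f, OF fin acyc f0]) (use that zero in \<open>auto dest: trancl_into_rtrancl\<close>)
    then show ?thesis using that zero[OF that(1) _ that(2), of l] f0 by auto
  qed
  have "unrolled E m Ne f j (\<lambda>a s. ?w a (s + m i j)) = unrolled E m Ne f j w"
    by (rule unrolled_cong[OF fin acyc]) (use irr in \<open>auto simp: branch_input_def\<close>)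
  moreover have "finite (in_neighbors E i)"
    by (rule finite_subset[of _ "snd ` E"]) (use fin in \<open>force simp: in_neighbors_def\<close>)+
  moreover have "(\<Sum>l\<in>in_neighbors E i - {j}. f i l ((if l \<in> Ne then ?w l (m i l + 1) else 0)
      + unrolled E m Ne f l (\<lambda>a s. ?w a (s + m i l)))) = 0"
  proof (intro sum.neutral ballI)
    fix l assume "l \<in> in_neighbors E i - {j}"
    then show "f i l ((if l \<in> Ne then ?w l (m i l + 1) else 0)
      + unrolled E m Ne f l (\<lambda>a s. ?w a (s + m i l))) = 0"
      by (intro other) (simp_all add: in_neighbors_def)
  qed
  moreover have "?w j (m i j + 1) = x" by (simp add: branch_input_def)
  moreover have "j \<in> in_neighbors E i" using ij by (simp add: in_neighbors_def)
  ultimately show ?thesis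
    unfolding unrolled_rec[OF fin acyc, of m Ne f i] by (simp add: sum.remove[of _ j])
qed

text \<open>One in-neighbour \<open>j\<close> suffices: solve \<open>f i j x = y\<close> and supply
  \<open>x\<close> through the input at \<open>j\<close> if \<open>j\<close> is excited. Otherwise
  \<open>j\<close> is no source, and the induction hypothesis supplies \<open>x\<close> as a value
  of the unrolled function at \<open>j\<close>.\<close>

lemma unrolled_surj:
  assumes tree: "directed_tree V E" and fin: "finite E"
    and f0: "\<forall>(a, b)\<in>E. f a b 0 = 0"
    and surj: "\<forall>(a, b)\<in>E. surj (f a b)"
    and src: "sources V E \<subseteq> Ne" and "in_neighbors E i \<noteq> {}"
  shows "\<exists>w. unrolled E m Ne f i w = y"
proof -
  have acyc: "acyclic E" by (rule directed_tree_acyclic[OF tree])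
  show ?thesis
    using assms(6)
  proof (induction i arbitrary: y rule: wf_induct_rule[OF finite_acyclic_wf_converse[OF fin acyc]])
    case (1 i)
    then obtain j where ij: "(i, j) \<in> E" by (auto simp: in_neighbors_def)
    have "surj (f i j)" using surj ij by blast
    then obtain x where x: "f i j x = y" by (metis surjD)
    note branch = unrolled_branch_input[where f = f, OF tree fin f0 ij]
    show ?case
    proof (cases "j \<in> Ne")
      case True
      have "unrolled E m Ne f j (\<lambda>_ _. 0) = 0"
        by (rule unrolled_zero[where f = f, OF fin acyc f0]) auto
      then have "unrolled E m Ne f i (branch_input E m i j x (\<lambda>_ _. 0)) = y"
        using True x by (simp add: branch)
      then show ?thesis by blast
    next
      case False
      then have "in_neighbors E j \<noteq> {}"
        using src ij tree by (auto simp: sources_def directed_tree_def)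
      then obtain w where "unrolled E m Ne f j w = x"
        using 1(1)[of j x] ij by auto
      then have "unrolled E m Ne f i (branch_input E m i j 0 w) = y"
        using x by (simp add: branch)
      then show ?thesis by blast
    qed
  qed
qed

section \<open>The function class\<close>

text \<open>All values are already taken on a compact interval, so the range is bounded.\<close>

lemma continuous_periodic_not_surj:
  fixes g :: "real \<Rightarrow> real"
  assumes cont: "continuous_on UNIV g" and per: "\<And>x. g (x + c) = g x" and "c \<noteq> 0"
  shows "\<not> surj g"
proof
  assume "surj g"
  have shift_nat: "g (x + real k * c) = g x" for x k
  proof (induction k)
    case (Suc k)
    then show ?case using per[of "x + real k * c"] by (simp add: algebra_simps)
  qed simp
  have shift: "g (x + of_int k * c) = g x" for x k
  proof (cases "k \<ge> 0")
    case True
    then show ?thesis using shift_nat[of x "nat k"] by simp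
  next
    case False
    \<comment> \<open>For negative \<open>k\<close>, start at the shifted point and move back to
      \<open>x\<close> by \<open>- k\<close> periods.\<close>
    then show ?thesis using shift_nat[of "x + of_int k * c" "nat (- k)"] by simp
  qed
  \<comment> \<open>The interval is symmetric because the reduced point
    \<open>frac (x / c) * c\<close> has the sign of \<open>c\<close> or is 0.\<close>
  have "range g \<subseteq> g ` {-\<bar>c\<bar>..\<bar>c\<bar>}"
  proof
    fix y assume "y \<in> range g"
    then obtain x where "y = g x" by blast
    moreover have "x + of_int (- \<lfloor>x / c\<rfloor>) * c = frac (x / c) * c"
      using \<open>c \<noteq> 0\<close> by (simp add: frac_def field_simps)
    moreover have "\<bar>frac (x / c) * c\<bar> \<le> \<bar>c\<bar>"
      using frac_lt_1[of "x / c"] frac_ge_0[of "x / c"]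
      by (simp add: abs_mult mult_left_le_one_le)
    ultimately show "y \<in> g ` {-\<bar>c\<bar>..\<bar>c\<bar>}"
      using shift[of x "- \<lfloor>x / c\<rfloor>"] by (intro rev_image_eqI[of "frac (x / c) * c"]) auto
  qed
  moreover have "bounded (g ` {-\<bar>c\<bar>..\<bar>c\<bar>})"
    by (intro compact_imp_bounded compact_continuous_image continuous_on_subset[OF cont]) auto
  ultimately have "bounded (UNIV :: real set)"
    using \<open>surj g\<close> bounded_subset by metis
  then show False by simp
qed

lemma real_analytic_continuous:
  assumes "real_analytic f"
  shows "continuous_on UNIV f"
proof -
  have "isCont f x" for x
  proof -
    obtain A where "(\<lambda>h. f (x + h)) has_fps_expansion A"
      using assms by (auto simp: real_analytic_def)
    then have "isCont (\<lambda>h. f (x + h)) 0"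
      by (rule has_fps_expansion_imp_continuous)
    then show ?thesis by (simp add: isCont_iff isCont_def)
  qed
  then show ?thesis by (simp add: continuous_on_eq_continuous_at)
qed

text \<open>Cubes serve for the counterexample: an odd power is onto, the exponent 3 makes it
  nonlinear, and homogeneity turns a rescaling of argument or value into a change of
  \<open>c\<close>.\<close>

lemma cube_in_class_Z_NL:
  assumes "c \<noteq> 0"
  shows "(\<lambda>x. c * x ^ 3) \<in> class_Z_NL"
proof -
  have "(\<lambda>h. c * (x + h) ^ 3) has_fps_expansion (fps_const c * (fps_const x + fps_X) ^ 3)" for x
    unfolding power3_eq_cube by (intro fps_expansion_intros)
  then have "real_analytic (\<lambda>x. c * x ^ 3)"
    by (auto simp: real_analytic_def)
  moreover have "(\<lambda>x. c * x ^ 3) has_fps_expansion (fps_const c * fps_X ^ 3)"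
    by (intro fps_expansion_intros)
  moreover have "fps_nth (fps_const c * fps_X ^ 3) 3 \<noteq> 0"
    using assms by simp
  moreover have "\<exists>x. y = c * x ^ 3" for y
    by (rule exI[of _ "root 3 (y / c)"]) (use assms in \<open>simp add: odd_real_root_pow\<close>)
  then have "surj (\<lambda>x. c * x ^ 3)"
    by (simp add: surj_def)
  moreover have "(3::nat) > 1" by simp
  ultimately show ?thesis
    unfolding class_Z_NL_def by fastforce
qed

section \<open>Identifiability\<close>

lemma identifiable_if_surj_continuous:
  assumes tree: "directed_tree V E" and fin: "finite E"
    and C: "\<And>g. g \<in> C \<Longrightarrow> continuous_on UNIV g \<and> g 0 = 0 \<and> surj g"
    and src: "sources V E \<subseteq> Ne" and snk: "sinks V E \<subseteq> Nm"
    and inner: "\<forall>i\<in>V - (sources V E \<union> sinks V E). i \<in> Ne \<or> i \<in> Nm"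
  shows "identifiable C E m Ne Nm"
proof -
  have acyc: "acyclic E" by (rule directed_tree_acyclic[OF tree])
  have EV: "E \<subseteq> V \<times> V" using tree by (simp add: directed_tree_def)
  have "f i j = f' i j"
    if fC: "\<forall>(i, j)\<in>E. f i j \<in> C \<and> f' i j \<in> C"
      and meas: "\<forall>i\<in>Nm. unrolled E m Ne f i = unrolled E m Ne f' i" and ij: "(i, j) \<in> E"
    for f f' i j
  proof -
    let ?F = "unrolled E m Ne f" and ?F' = "unrolled E m Ne f'"
    have f0: "\<forall>(a, b)\<in>E. f a b 0 = 0" "\<forall>(a, b)\<in>E. f' a b 0 = 0"
      and surj: "\<forall>(a, b)\<in>E. surj (f a b)"
      and cont: "\<forall>(a, b)\<in>E. continuous_on UNIV (f a b)"
      using fC C by fast+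
    \<comment> \<open>One move against an edge: agreement at its head \<open>i\<close> yields
      agreement on the edge and at its tail \<open>j\<close>.\<close>
    have step: "f i j = f' i j \<and> ?F j = ?F' j" if ij: "(i, j) \<in> E" and Fi: "?F i = ?F' i" for i j
    proof -
      have eq: "f i j ((if j \<in> Ne then x else 0) + ?F j w) =
          f' i j ((if j \<in> Ne then x else 0) + ?F' j w)" for x w
        using fun_cong[OF Fi, of "branch_input E m i j x w"]
          unrolled_branch_input[where f = f, OF tree fin f0(1) ij, of m Ne x w]
          unrolled_branch_input[where f = f', OF tree fin f0(2) ij, of m Ne x w]
        by simp
      show ?thesis
      proof (cases "j \<in> Ne")
        case True
        have "?F j (\<lambda>_ _. 0) = 0" "?F' j (\<lambda>_ _. 0) = 0"
          by (rule unrolled_zero[where f = f, OF fin acyc f0(1)] unrolled_zero[where f = f', OF fin acyc f0(2)]; simp)+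
        then have ff': "f i j = f' i j"
          using eq[of _ "\<lambda>_ _. 0"] True by auto
        have "?F j w = ?F' j w" for w
        proof (rule ccontr)
          assume "?F j w \<noteq> ?F' j w"
          \<comment> \<open>Choosing the input at \<open>j\<close> as \<open>x - ?F' j w\<close>
            exhibits the difference of the two unrolled values as a nonzero period of
            \<open>f i j\<close>.\<close>
          moreover have "f i j (x + (?F j w - ?F' j w)) = f i j x" for x
            using eq[of "x - ?F' j w" w] True ff' by (simp add: algebra_simps)
          moreover have "continuous_on UNIV (f i j)" "surj (f i j)"
            using cont surj ij by blast+
          ultimately show False
            using continuous_periodic_not_surj[of "f i j" "?F j w - ?F' j w"] by simp
        qed
        then show ?thesis using ff' by blast
      next
        case False
        then have "j \<notin> sources V E" using src by blast
        \<comment> \<open>The edge to \<open>i\<close> rules out a sink, so \<open>j\<close>, being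
          neither excited nor a source, must be measured.\<close>
        have "j \<notin> sinks V E" using ij by (auto simp: sinks_def out_neighbors_def)
        then have "j \<in> Nm"
          using inner False \<open>j \<notin> sources V E\<close> ij EV by auto
        then have Fj: "?F j = ?F' j" using meas by blast
        have nonempty: "in_neighbors E j \<noteq> {}"
          using \<open>j \<notin> sources V E\<close> ij EV by (auto simp: sources_def)
        have "f i j x = f' i j x" for x
        proof -
          \<comment> \<open>Both families produce the same \<open>x\<close> from this
            \<open>w\<close>, since \<open>?F j = ?F' j\<close>.\<close>
          obtain w where "?F j w = x"
            using unrolled_surj[where f = f, OF tree fin f0(1) surj src nonempty, of m x] by blast
          then show ?thesis using eq[of 0 w] False Fj by simp
        qed
        then show ?thesis using Fj by blast
      qed
    qed
    have "?F i = ?F' i" if "i \<in> V" for i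
      using that
    \<comment> \<open>Induction over \<open>E\<close> rather than its converse: the hypothesis
      concerns out-neighbours, and the sinks are the base case.\<close>
    proof (induction i rule: wf_induct_rule[OF finite_acyclic_wf[OF fin acyc]])
      case (1 i)
      show ?case
      proof (cases "i \<in> sinks V E")
        case True
        then show ?thesis using meas snk by blast
      next
        case False
        then obtain l where "(l, i) \<in> E" using 1(2) by (auto simp: sinks_def out_neighbors_def)
        then show ?thesis using 1(1) step EV by blast
      qed
    qed
    then show ?thesis using step ij EV by blast
  qed
  then show ?thesis unfolding identifiable_def by blast
qed

text \<open>The condition \<open>exc\<close> says that no outgoing edge adds an excitation to the
  rescaled signal of \<open>i\<close>; \<open>meas\<close> says that rescaling at \<open>i\<close>
  is not seen by a measurement.\<close>

lemma not_identifiable_if_rescalable: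
  assumes tree: "directed_tree V E" and fin: "finite E" and inc: "(i, j) \<in> E \<or> (j, i) \<in> E"
    and exc: "i \<notin> Ne \<or> i \<in> sinks V E" and meas: "i \<notin> Nm \<or> i \<in> sources V E"
  shows "\<not> identifiable class_Z_NL E m Ne Nm"
proof
  assume id: "identifiable class_Z_NL E m Ne Nm"
  have acyc: "acyclic E" by (rule directed_tree_acyclic[OF tree])
  define c :: "nat \<Rightarrow> real" where "c k = (if k = i then 2 else 1)" for k
  define f :: "nat \<Rightarrow> nat \<Rightarrow> real \<Rightarrow> real" where "f a b = (\<lambda>x. 1 * x ^ 3)" for a b
  \<comment> \<open>The numerator \<open>c a\<close> scales the output at \<open>a\<close>; the
    denominator removes the factor that cubing makes of the scaling at \<open>b\<close>.\<close>
  define f' :: "nat \<Rightarrow> nat \<Rightarrow> real \<Rightarrow> real" where "f' a b = (\<lambda>x. (c a / c b ^ 3) * x ^ 3)" for a b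
  have "c k \<noteq> 0" for k by (simp add: c_def)
  then have inC: "f a b \<in> class_Z_NL" "f' a b \<in> class_Z_NL" for a b
    unfolding f_def f'_def by (intro cube_in_class_Z_NL; simp)+
  have scale: "unrolled E m Ne f' k w = c k * unrolled E m Ne f k w" for k w
  proof (induction k arbitrary: w rule: wf_induct_rule[OF finite_acyclic_wf_converse[OF fin acyc]])
    case (1 k)
    have edge: "f' k b ((if b \<in> Ne then w b (m k b + 1) else 0) + unrolled E m Ne f' b (\<lambda>l s. w l (s + m k b)))
      = c k * f k b ((if b \<in> Ne then w b (m k b + 1) else 0) + unrolled E m Ne f b (\<lambda>l s. w l (s + m k b)))"
      if "(k, b) \<in> E" for b
    proof -
      \<comment> \<open>Scaling the argument by \<open>c i = 2\<close> needs the excitation term to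
        vanish; at all other nodes the factor is 1.\<close>
      have "b \<notin> Ne" if "b = i"
        using exc \<open>(k, b) \<in> E\<close> that by (auto simp: sinks_def out_neighbors_def)
      then show ?thesis
        using 1[of b "\<lambda>l s. w l (s + m k b)"] that
        by (cases "b = i") (auto simp: f_def[of k] f'_def[of k] c_def power_mult_distrib)
    qed
    show ?case
      unfolding unrolled_rec[OF fin acyc, of m Ne _ k] sum_distrib_left
      by (intro sum.cong refl edge) (simp add: in_neighbors_def)
  qed
  have "unrolled E m Ne f k = unrolled E m Ne f' k" if "k \<in> Nm" for k
  proof
    fix w
    \<comment> \<open>A measured \<open>i\<close> is a source, so its unrolled function is an empty
      sum and doubling it changes nothing.\<close>
    have "unrolled E m Ne f k w = 0" if "k = i"
      using meas \<open>k \<in> Nm\<close> that by (simp add: unrolled_rec[OF fin acyc, of m Ne f i] sources_def)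
    then show "unrolled E m Ne f k w = unrolled E m Ne f' k w"
      using scale[of k w] by (cases "k = i") (auto simp: c_def)
  qed
  then have "\<forall>(a, b)\<in>E. f a b = f' a b"
    using id[unfolded identifiable_def, rule_format, of f f'] inC by blast
  then have eq: "f a b 1 = f' a b 1" if "(a, b) \<in> E" for a b
    using that by fastforce
  have "i \<noteq> j" using inc acyc by (auto simp: acyclic_def)
  then show False
    \<comment> \<open>At argument 1 the two families give 1 against 2 on an edge into
      \<open>i\<close>, and 1 against 1/8 on an edge out of \<open>i\<close>.\<close>
    using inc eq[of i j] eq[of j i] by (auto simp: f_def f'_def c_def)
qed

lemma directed_tree_incident_edge:
  assumes "directed_tree V E" "i \<in> V" "k \<in> V" "i \<noteq> k"
  obtains j where "(i, j) \<in> E \<or> (j, i) \<in> E"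
proof -
  have "(i, k) \<in> (E \<union> E\<inverse>)\<^sup>*" using assms by (auto simp: directed_tree_def)
  then show thesis using that \<open>i \<noteq> k\<close> by (auto elim: converse_rtranclE)
qed

theorem proposition4:
  fixes n :: nat and E :: "(nat \<times> nat) set" and m :: "nat \<Rightarrow> nat \<Rightarrow> nat" and Ne Nm :: "nat set"
  assumes "n \<ge> 2"
    and "directed_tree {1..n} E"
    and "\<forall>(i, j)\<in>E. m i j \<ge> 1"
    and "Ne \<subseteq> {1..n}" and "Nm \<subseteq> {1..n}"
    and "card Ne + card Nm = n"
  shows "identifiable class_Z_NL E m Ne Nm \<longleftrightarrow>
    sources {1..n} E \<subseteq> Ne \<and> sinks {1..n} E \<subseteq> Nm \<and>
    (\<forall>i\<in>{1..n} - (sources {1..n} E \<union> sinks {1..n} E). i \<in> Ne \<or> i \<in> Nm)"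
proof
  have fin: "finite E" using directed_tree_finite[OF assms(2)] by simp
  {
    assume id: "identifiable class_Z_NL E m Ne Nm"
    have "\<not> ((i \<notin> Ne \<or> i \<in> sinks {1..n} E) \<and> (i \<notin> Nm \<or> i \<in> sources {1..n} E))"
      if "i \<in> {1..n}" for i
    proof -
      obtain k where "k \<in> {1..n}" "i \<noteq> k"
        using \<open>n \<ge> 2\<close> that
        by (metis One_nat_def Suc_1 Suc_leD Suc_n_not_le_n atLeastAtMost_iff le_refl)
      then obtain j where "(i, j) \<in> E \<or> (j, i) \<in> E"
        using directed_tree_incident_edge[OF assms(2) \<open>i \<in> {1..n}\<close>] by blast
      then show ?thesis
        using not_identifiable_if_rescalable[OF assms(2) fin] id by blast
    qed
    \<comment> \<open>At a source the second conjunct holds, so the first must fail and the source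
      is excited; dually, a sink is measured. At any other node, failing one conjunct means being
      excited or measured.\<close>
    then show "sources {1..n} E \<subseteq> Ne \<and> sinks {1..n} E \<subseteq> Nm \<and>
      (\<forall>i\<in>{1..n} - (sources {1..n} E \<union> sinks {1..n} E). i \<in> Ne \<or> i \<in> Nm)"
      unfolding sources_def sinks_def by blast
  }
  assume "sources {1..n} E \<subseteq> Ne \<and> sinks {1..n} E \<subseteq> Nm \<and>
    (\<forall>i\<in>{1..n} - (sources {1..n} E \<union> sinks {1..n} E). i \<in> Ne \<or> i \<in> Nm)"
  then show "identifiable class_Z_NL E m Ne Nm"
    by (intro identifiable_if_surj_continuous[OF assms(2) fin])
       (auto simp: class_Z_NL_def real_analytic_continuous)
qed

end
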